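(* The following statements are equivalent for a uniform space $(X,\mu)$: (1) $X$ is compact; (2) $(X,\mu)$ is Bourbaki-bounded and Bourbaki-complete; (3) $(X,\mu)$ is totally bounded and complete; (4) $(X,s_f\mu)$ is Bourbaki-bounded and Bourbaki-complete; (5) $(X,s_f\mu)$ is totally bounded and complete.
   Context: Uniform spaces are Hausdorff and given by covers: $\mu$ is a family of covers of $X$ (the uniform covers), containing every cover refined by a member of $\mu$, and such that any two members of $\mu$ have a common star-refinement in $\mu$. For a cover $\mathcal U$ of $X$ and $A\subset X$: $St(A,\mathcal U)=\bigcup\{U\in\mathcal U: U\cap A\neq\emptyset\}$, $St^0(A,\mathcal U)=A$, $St^m(A,\mathcal U)=St(St^{m-1}(A,\mathcal U),\mathcal U)$ for $m\geq 1$. $(X,\mu)$ is Bourbaki-bounded if for every $\mathcal U\in\mu$ there are $m\in\mathbb N$ and finitely many $U_1,\dots,U_k\in\mathcal U$ with $X\subset\bigcup_{i=1}^k St^m(U_i,\mathcal U)$. It is totally bounded if for every $\mathcal U\in\mu$ there are finitely many $U_1,\dots,U_k\in\mathcal U$ with $X=\bigcup_{i=1}^k U_i$. A filter $\mathcal F$ on $X$ is Bourbaki-Cauchy if for every $\mathcal U\in\mu$ there are $m\in\mathbb N$, $U\in\mathcal U$ and $F\in\mathcal F$ with $F\subset St^m(U,\mathcal U)$. $(X,\mu)$ is Bourbaki-complete if every Bourbaki-Cauchy filter has a cluster point; it is complete if every Cauchy filter has a cluster point (equivalently, converges). A cover is star-finite if each of its members meets at most finitely many of its members. $s_f\mu$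 denotes the uniformity on $X$ (compatible with the topology of $X$) having as a base the family of all star-finite open covers belonging to $\mu$. *)

theory Defs
  imports "HOL-Analysis.Analysis"
begin

definition is_cover :: "'a set \<Rightarrow> 'a set set \<Rightarrow> bool" where
  "is_cover X \<U> \<longleftrightarrow> \<U> \<subseteq> Pow X \<and> \<Union>\<U> = X"

definition cover_refines :: "'a set set \<Rightarrow> 'a set set \<Rightarrow> bool" where
  "cover_refines \<U> \<V> \<longleftrightarrow> (\<forall>U\<in>\<U>. \<exists>V\<in>\<V>. U \<subseteq> V)"

definition St :: "'a set \<Rightarrow> 'a set set \<Rightarrow> 'a set" where
  "St A \<U> = \<Union>{U \<in> \<U>. U \<inter> A \<noteq> {}}"

primrec Stn :: "nat \<Rightarrow> 'a set \<Rightarrow> 'a set set \<Rightarrow> 'a set" where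
  "Stn 0 A \<U> = A"
| "Stn (Suc m) A \<U> = St (Stn m A \<U>) \<U>"

definition star_refines :: "'a set set \<Rightarrow> 'a set set \<Rightarrow> bool" where
  "star_refines \<U> \<V> \<longleftrightarrow> cover_refines ((\<lambda>U. St U \<U>) ` \<U>) \<V>"

definition covering_uniformity :: "'a set \<Rightarrow> 'a set set set \<Rightarrow> bool" where
  "covering_uniformity X \<mu> \<longleftrightarrow>
     \<mu> \<noteq> {} \<and>
     (\<forall>\<U>\<in>\<mu>. is_cover X \<U>) \<and>
     (\<forall>\<U>\<in>\<mu>. \<forall>\<V>. is_cover X \<V> \<and> cover_refines \<U> \<V> \<longrightarrow> \<V> \<in> \<mu>) \<and>
     (\<forall>\<U>\<in>\<mu>. \<forall>\<V>\<in>\<mu>. \<exists>\<W>\<in>\<mu>. star_refines \<W> \<U> \<and> star_refines \<W> \<V>)"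

definition unif_topology :: "'a set \<Rightarrow> 'a set set set \<Rightarrow> 'a topology" where
  "unif_topology X \<mu> = topology (\<lambda>G. G \<subseteq> X \<and> (\<forall>x\<in>G. \<exists>\<U>\<in>\<mu>. St {x} \<U> \<subseteq> G))"

text \<open>Uniform spaces are required to be Hausdorff.\<close>

definition uniform_space_on :: "'a set \<Rightarrow> 'a set set set \<Rightarrow> bool" where
  "uniform_space_on X \<mu> \<longleftrightarrow> covering_uniformity X \<mu> \<and> Hausdorff_space (unif_topology X \<mu>)"

definition Bourbaki_bounded :: "'a set \<Rightarrow> 'a set set set \<Rightarrow> bool" where
  "Bourbaki_bounded X \<mu> \<longleftrightarrow>
     (\<forall>\<U>\<in>\<mu>. \<exists>m. \<exists>\<V>. finite \<V> \<and> \<V> \<subseteq> \<U> \<and> X \<subseteq> (\<Union>V\<in>\<V>. Stn m V \<U>))"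

definition unif_totally_bounded :: "'a set \<Rightarrow> 'a set set set \<Rightarrow> bool" where
  "unif_totally_bounded X \<mu> \<longleftrightarrow> (\<forall>\<U>\<in>\<mu>. \<exists>\<V>. finite \<V> \<and> \<V> \<subseteq> \<U> \<and> X = \<Union>\<V>)"

text \<open>The library's filters live on the whole type and may be improper (\<open>bot\<close>), so
  a filter on the set \<open>X\<close> is a proper filter containing \<open>X\<close>; a set \<open>A\<close> is a member
  of \<open>F\<close> iff \<open>eventually (\<lambda>x. x \<in> A) F\<close>.\<close>

definition filter_on :: "'a set \<Rightarrow> 'a filter \<Rightarrow> bool" where
  "filter_on X F \<longleftrightarrow> F \<noteq> bot \<and> eventually (\<lambda>x. x \<in> X) F"

definition Cauchy_filter_on :: "'a set \<Rightarrow> 'a set set set \<Rightarrow> 'a filter \<Rightarrow> bool" where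
  "Cauchy_filter_on X \<mu> F \<longleftrightarrow> filter_on X F \<and>
     (\<forall>\<U>\<in>\<mu>. \<exists>U\<in>\<U>. eventually (\<lambda>x. x \<in> U) F)"

definition Bourbaki_Cauchy_filter_on :: "'a set \<Rightarrow> 'a set set set \<Rightarrow> 'a filter \<Rightarrow> bool" where
  "Bourbaki_Cauchy_filter_on X \<mu> F \<longleftrightarrow> filter_on X F \<and>
     (\<forall>\<U>\<in>\<mu>. \<exists>m. \<exists>U\<in>\<U>. eventually (\<lambda>x. x \<in> Stn m U \<U>) F)"

definition cluster_point :: "'a topology \<Rightarrow> 'a filter \<Rightarrow> 'a \<Rightarrow> bool" where
  "cluster_point T F x \<longleftrightarrow> (\<forall>A. eventually (\<lambda>y. y \<in> A) F \<longrightarrow> x \<in> T closure_of A)"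

definition unif_complete :: "'a set \<Rightarrow> 'a set set set \<Rightarrow> bool" where
  "unif_complete X \<mu> \<longleftrightarrow>
     (\<forall>F. Cauchy_filter_on X \<mu> F \<longrightarrow> (\<exists>x. cluster_point (unif_topology X \<mu>) F x))"

definition Bourbaki_complete :: "'a set \<Rightarrow> 'a set set set \<Rightarrow> bool" where
  "Bourbaki_complete X \<mu> \<longleftrightarrow>
     (\<forall>F. Bourbaki_Cauchy_filter_on X \<mu> F \<longrightarrow> (\<exists>x. cluster_point (unif_topology X \<mu>) F x))"

definition star_finite :: "'a set set \<Rightarrow> bool" where
  "star_finite \<U> \<longleftrightarrow> (\<forall>U\<in>\<U>. finite {V \<in> \<U>. V \<inter> U \<noteq> {}})"

definition sf_base :: "'a set \<Rightarrow> 'a set set set \<Rightarrow> 'a set set set" where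
  "sf_base X \<mu> = {\<U> \<in> \<mu>. star_finite \<U> \<and> (\<forall>U\<in>\<U>. openin (unif_topology X \<mu>) U)}"

text \<open>A uniformity consists of all covers refined by some member of a base of it.\<close>

definition sf_uniformity :: "'a set \<Rightarrow> 'a set set set \<Rightarrow> 'a set set set" where
  "sf_uniformity X \<mu> = {\<V>. is_cover X \<V> \<and> (\<exists>\<U>\<in>sf_base X \<mu>. cover_refines \<U> \<V>)}"

text \<open>The predicate in \<^const>\<open>unif_topology\<close> is a topology as soon as the family of covers
  is directed under refinement.\<close>

lemma cover_refines_refl: "cover_refines \<U> \<U>"
  unfolding cover_refines_def by auto

lemma cover_refines_trans: "cover_refines \<U> \<V> \<Longrightarrow> cover_refines \<V> \<W> \<Longrightarrow> cover_refines \<U> \<W>"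
  unfolding cover_refines_def by (meson order_trans)

lemma St_mono_refines: "cover_refines \<W> \<U> \<Longrightarrow> St A \<W> \<subseteq> St A \<U>"
  unfolding cover_refines_def St_def by blast

lemma star_refinesE:
  assumes "star_refines \<W> \<U>" "W \<in> \<W>"
  obtains U where "U \<in> \<U>" "St W \<W> \<subseteq> U"
  using assms unfolding star_refines_def cover_refines_def by auto

lemma subset_St: "W \<in> \<W> \<Longrightarrow> W \<subseteq> St W \<W>"
  unfolding St_def by auto

lemma star_refines_imp_refines:
  assumes "star_refines \<W> \<U>"
  shows "cover_refines \<W> \<U>"
  unfolding cover_refines_def
proof
  fix W assume W: "W \<in> \<W>"
  obtain U where "U \<in> \<U>" "St W \<W> \<subseteq> U" using star_refinesE[OF assms W] .
  then show "\<exists>U\<in>\<U>. W \<subseteq> U" using subset_St[OF W] by (intro bexI[of _ U]) auto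
qed

lemma openin_unif_topology_directed:
  assumes "\<mu> \<noteq> {}" and cov: "\<And>\<U>. \<U> \<in> \<mu> \<Longrightarrow> is_cover X \<U>"
    and dir: "\<And>\<U> \<V>. \<U> \<in> \<mu> \<Longrightarrow> \<V> \<in> \<mu> \<Longrightarrow> \<exists>\<W>\<in>\<mu>. cover_refines \<W> \<U> \<and> cover_refines \<W> \<V>"
  shows "openin (unif_topology X \<mu>) G \<longleftrightarrow> G \<subseteq> X \<and> (\<forall>x\<in>G. \<exists>\<U>\<in>\<mu>. St {x} \<U> \<subseteq> G)"
    and "topspace (unif_topology X \<mu>) = X"
proof -
  define P where "P G \<longleftrightarrow> G \<subseteq> X \<and> (\<forall>x\<in>G. \<exists>\<U>\<in>\<mu>. St {x} \<U> \<subseteq> G)" for G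
  have 1: "P (S \<inter> T)" if S: "P S" and T: "P T" for S T
    unfolding P_def
  proof (intro conjI ballI)
    show "S \<inter> T \<subseteq> X" using S by (simp add: P_def le_infI1)
    fix x assume x: "x \<in> S \<inter> T"
    obtain \<U> where U: "\<U> \<in> \<mu>" "St {x} \<U> \<subseteq> S" using S x unfolding P_def by auto
    obtain \<V> where V: "\<V> \<in> \<mu>" "St {x} \<V> \<subseteq> T" using T x unfolding P_def by auto
    obtain \<W> where W: "\<W> \<in> \<mu>" "cover_refines \<W> \<U>" "cover_refines \<W> \<V>"
      using dir[OF U(1) V(1)] by auto
    have "St {x} \<W> \<subseteq> S \<inter> T"
      using St_mono_refines[OF W(2), of "{x}"] St_mono_refines[OF W(3), of "{x}"] U(2) V(2) by blast
    then show "\<exists>\<W>\<in>\<mu>. St {x} \<W> \<subseteq> S \<inter> T" using W(1) by (rule bexI)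
  qed
  have 2: "P (\<Union>\<K>)" if K: "\<forall>K\<in>\<K>. P K" for \<K>
    unfolding P_def
  proof (intro conjI ballI)
    show "\<Union>\<K> \<subseteq> X" using K by (simp add: P_def Union_least)
    fix x assume "x \<in> \<Union>\<K>"
    then obtain K0 where K0: "K0 \<in> \<K>" "x \<in> K0" by blast
    then have "P K0" using K by simp
    then obtain \<U> where "\<U> \<in> \<mu>" "St {x} \<U> \<subseteq> K0" using K0(2) unfolding P_def by auto
    then show "\<exists>\<U>\<in>\<mu>. St {x} \<U> \<subseteq> \<Union>\<K>" using K0(1) by (intro bexI[of _ \<U>] order_trans[OF _ Union_upper])
  qed
  have "istopology P" unfolding istopology_def using 1 2 by presburger
  then have "openin (topology P) = P" by (rule topology_inverse')
  moreover have "unif_topology X \<mu> = topology P"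
    unfolding unif_topology_def P_def ..
  ultimately have *: "openin (unif_topology X \<mu>) = P" by simp
  then show "openin (unif_topology X \<mu>) G \<longleftrightarrow> G \<subseteq> X \<and> (\<forall>x\<in>G. \<exists>\<U>\<in>\<mu>. St {x} \<U> \<subseteq> G)"
    by (simp add: P_def)
  obtain \<U> where "\<U> \<in> \<mu>" using assms(1) by blast
  moreover from this have "St {x} \<U> \<subseteq> X" for x
    using cov[of \<U>] unfolding is_cover_def St_def by auto
  ultimately have "P X" unfolding P_def by (intro conjI ballI bexI[of _ \<U>] order_refl)
  then show "topspace (unif_topology X \<mu>) = X"
    by (metis * P_def openin_subset openin_topspace subset_antisym)
qed

lemma covering_uniformityD:
  assumes "covering_uniformity X \<mu>"
  shows "\<mu> \<noteq> {}" "\<And>\<U>. \<U> \<in> \<mu> \<Longrightarrow> is_cover X \<U>"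
    "\<And>\<U> \<V>. \<U> \<in> \<mu> \<Longrightarrow> is_cover X \<V> \<Longrightarrow> cover_refines \<U> \<V> \<Longrightarrow> \<V> \<in> \<mu>"
    "\<And>\<U> \<V>. \<U> \<in> \<mu> \<Longrightarrow> \<V> \<in> \<mu> \<Longrightarrow> \<exists>\<W>\<in>\<mu>. star_refines \<W> \<U> \<and> star_refines \<W> \<V>"
    "\<And>\<U> \<V>. \<U> \<in> \<mu> \<Longrightarrow> \<V> \<in> \<mu> \<Longrightarrow> \<exists>\<W>\<in>\<mu>. cover_refines \<W> \<U> \<and> cover_refines \<W> \<V>"
proof -
  note a = assms[unfolded covering_uniformity_def]
  show "\<mu> \<noteq> {}" by (rule conjunct1[OF a])
  show "is_cover X \<U>" if "\<U> \<in> \<mu>" for \<U>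
    by (rule bspec[OF conjunct1[OF conjunct2[OF a]] that])
  show "\<V> \<in> \<mu>" if "\<U> \<in> \<mu>" "is_cover X \<V>" "cover_refines \<U> \<V>" for \<U> \<V>
    using bspec[OF conjunct1[OF conjunct2[OF conjunct2[OF a]]] that(1)] that(2,3) by simp
  show *: "\<exists>\<W>\<in>\<mu>. star_refines \<W> \<U> \<and> star_refines \<W> \<V>" if "\<U> \<in> \<mu>" "\<V> \<in> \<mu>" for \<U> \<V>
    by (rule bspec[OF bspec[OF conjunct2[OF conjunct2[OF conjunct2[OF a]]] that(1)] that(2)])
  show "\<exists>\<W>\<in>\<mu>. cover_refines \<W> \<U> \<and> cover_refines \<W> \<V>" if "\<U> \<in> \<mu>" "\<V> \<in> \<mu>" for \<U> \<V>
    using *[OF that] by (auto intro: star_refines_imp_refines)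
qed

lemma openin_unif_topology:
  assumes "covering_uniformity X \<mu>"
  shows "openin (unif_topology X \<mu>) G \<longleftrightarrow> G \<subseteq> X \<and> (\<forall>x\<in>G. \<exists>\<U>\<in>\<mu>. St {x} \<U> \<subseteq> G)"
    and "topspace (unif_topology X \<mu>) = X"
  by (rule openin_unif_topology_directed[OF covering_uniformityD(1,2,5)[OF assms]]; assumption)+

text \<open>The star-finite open uniform covers are indeed a base of a uniformity, compatible with
  the topology.\<close>

lemma star_refines_point:
  assumes "star_refines \<W> \<U>" "is_cover X \<W>" "x \<in> X"
  obtains U where "U \<in> \<U>" "x \<in> U" "St {x} \<W> \<subseteq> U"
proof -
  obtain W where W: "W \<in> \<W>" "x \<in> W" using assms unfolding is_cover_def by blast
  obtain U where "U \<in> \<U>" "St W \<W> \<subseteq> U" using star_refinesE[OF assms(1) W(1)] .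
  moreover have "St {x} \<W> \<subseteq> St W \<W>" "x \<in> St {x} \<W>" using W unfolding St_def by blast+
  ultimately show thesis using that by blast
qed

lemma openin_unif_interior:
  assumes u: "covering_uniformity X \<mu>"
  shows "openin (unif_topology X \<mu>) {z \<in> X. \<exists>\<Q>\<in>\<mu>. St {z} \<Q> \<subseteq> A}"
  unfolding openin_unif_topology(1)[OF u]
proof (intro conjI ballI)
  note uD = covering_uniformityD[OF u]
  let ?O = "{z \<in> X. \<exists>\<Q>\<in>\<mu>. St {z} \<Q> \<subseteq> A}"
  show "?O \<subseteq> X" by blast
  fix z assume "z \<in> ?O"
  then obtain \<Q> where Q: "\<Q> \<in> \<mu>" "St {z} \<Q> \<subseteq> A" "z \<in> X" by blast
  obtain \<R> where R: "\<R> \<in> \<mu>" "star_refines \<R> \<Q>" using uD(4)[OF Q(1) Q(1)] by blast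
  have "St {z} \<R> \<subseteq> ?O"
  proof
    fix w assume "w \<in> St {z} \<R>"
    then obtain R0 where R0: "R0 \<in> \<R>" "z \<in> R0" "w \<in> R0" unfolding St_def by blast
    obtain Q0 where Q0: "Q0 \<in> \<Q>" "St R0 \<R> \<subseteq> Q0" using star_refinesE[OF R(2) R0(1)] .
    have "z \<in> St R0 \<R>" "St {w} \<R> \<subseteq> St R0 \<R>" using R0 unfolding St_def by blast+
    then have "St {w} \<R> \<subseteq> A" using Q0 Q(2) unfolding St_def by blast
    moreover have "w \<in> X" using R0 uD(2)[OF R(1)] unfolding is_cover_def by blast
    ultimately show "w \<in> ?O" using R(1) by blast
  qed
  then show "\<exists>\<R>\<in>\<mu>. St {z} \<R> \<subseteq> ?O" using R(1) by blast
qed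

lemma sf_base_barycentric:
  assumes u: "covering_uniformity X \<mu>" and U: "\<U> \<in> sf_base X \<mu>"
  shows "\<exists>\<N>\<in>sf_base X \<mu>. \<forall>x\<in>X. \<exists>A\<in>\<U>. St {x} \<N> \<subseteq> A"
proof (cases "\<U> = {}")
  case True
  then have "X = {}" using U covering_uniformityD(2)[OF u] unfolding sf_base_def is_cover_def by auto
  then show ?thesis using U by blast
next
  case ne: False
  let ?T = "unif_topology X \<mu>"
  note op = openin_unif_topology[OF u] and uD = covering_uniformityD[OF u]
  have U\<mu>: "\<U> \<in> \<mu>" and sf: "\<And>A. A \<in> \<U> \<Longrightarrow> finite {B \<in> \<U>. B \<inter> A \<noteq> {}}"
    and opU: "\<And>A. A \<in> \<U> \<Longrightarrow> openin ?T A"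
    using U unfolding sf_base_def star_finite_def by auto
  have covU: "\<Union>\<U> = X" using uD(2)[OF U\<mu>] unfolding is_cover_def by blast
  obtain \<V> where V: "\<V> \<in> \<mu>" "star_refines \<V> \<U>" using uD(4)[OF U\<mu> U\<mu>] by blast
  obtain \<W> where W: "\<W> \<in> \<mu>" "star_refines \<W> \<V>" using uD(4)[OF V(1) V(1)] by blast
  obtain \<Z> where Z: "\<Z> \<in> \<mu>" "star_refines \<Z> \<W>" using uD(4)[OF W(1) W(1)] by blast
  define sh where "sh A = {x \<in> X. St {x} \<V> \<subseteq> A}" for A
  define N where "N S = {x \<in> X. \<forall>A\<in>\<U>. if A \<in> S then x \<in> A else x \<notin> ?T closure_of sh A}" for S
  define \<N> where "\<N> = N ` {S. S \<subseteq> \<U> \<and> S \<noteq> {}}"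
  have N_in: "x \<in> A" if "x \<in> N S" "A \<in> S" "S \<subseteq> \<U>" for x A S using that unfolding N_def by auto
  have N_out: "x \<notin> ?T closure_of sh A" if "x \<in> N S" "A \<notin> S" "A \<in> \<U>" for x A S
    using that unfolding N_def by auto
  have sh_cl: "sh A \<subseteq> ?T closure_of sh A" for A
    by (rule closure_of_subset) (auto simp: op(2) sh_def)
  have sh_sub: "sh A \<subseteq> A" for A
    using uD(2)[OF V(1)] unfolding is_cover_def St_def sh_def by blast
  have bary: "\<exists>A\<in>\<U>. St {x} \<N> \<subseteq> A" if x: "x \<in> X" for x
  proof -
    obtain A where A: "A \<in> \<U>" "St {x} \<V> \<subseteq> A" using star_refines_point[OF V(2) uD(2)[OF V(1)] x] .
    then have xs: "x \<in> sh A" using x unfolding sh_def by blast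
    have "N S \<subseteq> A" if "x \<in> N S" "S \<subseteq> \<U>" for S
    proof -
      have "A \<in> S" using N_out[OF that(1) _ A(1)] sh_cl[of A] xs by blast
      then show ?thesis using N_in that(2) by blast
    qed
    then show ?thesis using A(1) unfolding St_def \<N>_def by blast
  qed
  have opN: "openin ?T (N S)" if S: "S \<subseteq> \<U>" "S \<noteq> {}" for S
  proof (cases "N S = {}")
    case False
    obtain A0 where A0: "A0 \<in> S" using S by blast
    let ?F = "{B \<in> \<U>. B \<inter> A0 \<noteq> {}}"
    let ?g = "\<lambda>B. if B \<in> S then B else X - ?T closure_of sh B"
    have fin: "finite ?F" using sf A0 S by blast
    have oA0: "openin ?T A0" using opU A0 S by blast
    have SF: "S \<subseteq> ?F" using False N_in[OF _ _ S(1)] A0 S by blast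
    have og: "openin ?T (?g B)" if "B \<in> ?F" for B
      using that opU openin_diff[OF openin_topspace closedin_closure_of, of ?T "sh B"] op(2) by auto
    have far: "A0 \<inter> ?T closure_of sh B = {}" if "B \<inter> A0 = {}" for B
      using sh_sub[of B] that by (subst openin_Int_closure_of_eq_empty[OF oA0]) blast
    have eq: "N S = A0 \<inter> \<Inter>(?g ` ?F)"
    proof (intro equalityI subsetI)
      fix x assume x: "x \<in> N S"
      have "x \<in> X" using x unfolding N_def by blast
      moreover have "x \<in> A0" using N_in[OF x A0 S(1)] .
      moreover have "x \<in> ?g B" if "B \<in> ?F" for B
        using N_in[OF x _ S(1)] N_out[OF x] that \<open>x \<in> X\<close> by auto
      ultimately show "x \<in> A0 \<inter> \<Inter>(?g ` ?F)" by blast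
    next
      fix x assume x: "x \<in> A0 \<inter> \<Inter>(?g ` ?F)"
      have "if B \<in> S then x \<in> B else x \<notin> ?T closure_of sh B" if B: "B \<in> \<U>" for B
      proof (cases "B \<inter> A0 = {}")
        case True
        then have "B \<notin> S" using SF by blast
        then show ?thesis using far[OF True] x by auto
      next
        case False
        then have "x \<in> ?g B" using x B by blast
        then show ?thesis by (auto split: if_splits)
      qed
      moreover have "x \<in> X" using x A0 S covU by blast
      ultimately show "x \<in> N S" unfolding N_def by blast
    qed
    have "openin ?T (\<Inter>(?g ` ?F))"
    proof (rule openin_Inter)
      show "finite (?g ` ?F)" using fin by blast
      show "?g ` ?F \<noteq> {}" using A0 SF by blast
      show "openin ?T K" if "K \<in> ?g ` ?F" for K using that og by blast
    qed
    then show ?thesis unfolding eq by (rule openin_Int[OF oA0])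
  qed simp
  have sfN: "star_finite \<N>"
    unfolding star_finite_def
  proof
    fix M assume "M \<in> \<N>"
    then obtain S where S: "M = N S" "S \<subseteq> \<U>" "S \<noteq> {}" unfolding \<N>_def by blast
    then obtain A0 where A0: "A0 \<in> S" by blast
    have "{M' \<in> \<N>. M' \<inter> M \<noteq> {}} \<subseteq> N ` Pow {B \<in> \<U>. B \<inter> A0 \<noteq> {}}"
    proof
      fix M' assume "M' \<in> {M' \<in> \<N>. M' \<inter> M \<noteq> {}}"
      then obtain S' x where S': "M' = N S'" "S' \<subseteq> \<U>" "x \<in> N S'" "x \<in> N S"
        unfolding \<N>_def S(1) by blast
      have "S' \<subseteq> {B \<in> \<U>. B \<inter> A0 \<noteq> {}}"
        using N_in[OF S'(3) _ S'(2)] N_in[OF S'(4) A0 S(2)] S'(2) by blast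
      then show "M' \<in> N ` Pow {B \<in> \<U>. B \<inter> A0 \<noteq> {}}" using S' by blast
    qed
    then show "finite {M' \<in> \<N>. M' \<inter> M \<noteq> {}}"
      using finite_subset sf A0 S(2) by (meson finite_Pow_iff finite_imageI in_mono)
  qed
  have fine: "\<exists>M\<in>\<N>. St {x} \<Z> \<subseteq> M" if x: "x \<in> X" for x
  proof -
    obtain W1 where W1: "W1 \<in> \<W>" "x \<in> W1" "St {x} \<Z> \<subseteq> W1"
      using star_refines_point[OF Z(2) uD(2)[OF Z(1)] x] .
    obtain V1 where V1: "V1 \<in> \<V>" "St W1 \<W> \<subseteq> V1" using star_refinesE[OF W(2) W1(1)] .
    have W1V1: "W1 \<subseteq> V1" using V1(2) W1 unfolding St_def by blast
    obtain U1 where U1: "U1 \<in> \<U>" "St V1 \<V> \<subseteq> U1" using star_refinesE[OF V(2) V1(1)] .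
    have V1U1: "V1 \<subseteq> U1" using U1(2) V1(1) W1V1 W1(2) unfolding St_def by blast
    define S where "S = {A \<in> \<U>. St {x} \<Z> \<subseteq> A}"
    have "U1 \<in> S" using U1(1) W1(3) W1V1 V1U1 unfolding S_def by blast
    moreover have "St {x} \<Z> \<subseteq> N S"
    proof
      fix y assume y: "y \<in> St {x} \<Z>"
      have yX: "y \<in> X" using y uD(2)[OF Z(1)] unfolding St_def is_cover_def by blast
      have yW1: "y \<in> W1" using y W1(3) by blast
      have "y \<notin> ?T closure_of sh A" if A: "A \<in> \<U>" "A \<notin> S" for A
      proof
        let ?O = "{z \<in> X. \<exists>\<Q>\<in>\<mu>. St {z} \<Q> \<subseteq> St {y} \<W>}"
        assume "y \<in> ?T closure_of sh A"
        then have "\<exists>a. a \<in> sh A \<and> a \<in> T" if "y \<in> T" "openin ?T T" for T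
          using that by (simp add: in_closure_of)
        moreover have "y \<in> ?O" using yX W(1) by blast
        ultimately have "\<exists>a. a \<in> sh A \<and> a \<in> ?O" using openin_unif_interior[OF u] by meson
        then obtain a \<Q> where a: "a \<in> sh A" "a \<in> X" "\<Q> \<in> \<mu>" "St {a} \<Q> \<subseteq> St {y} \<W>" by blast
        have "a \<in> St {a} \<Q>" using uD(2)[OF a(3)] a(2) unfolding is_cover_def St_def by blast
        then have "a \<in> St {y} \<W>" using a(4) by blast
        then have "a \<in> St W1 \<W>" using yW1 unfolding St_def by blast
        then have "V1 \<subseteq> St {a} \<V>" using V1 unfolding St_def by blast
        then have "V1 \<subseteq> A" using a(1) unfolding sh_def by blast
        then show False using A W1(3) W1V1 unfolding S_def by blast
      qed
      then show "y \<in> N S" using y yX unfolding N_def S_def by auto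
    qed
    ultimately show ?thesis unfolding \<N>_def S_def by blast
  qed
  have "N \<U> \<in> \<N>" using ne unfolding \<N>_def by blast
  have "cover_refines \<Z> \<N>"
    unfolding cover_refines_def
  proof
    fix Z0 assume Z0: "Z0 \<in> \<Z>"
    show "\<exists>M\<in>\<N>. Z0 \<subseteq> M"
    proof (cases "Z0 = {}")
      case True then show ?thesis using \<open>N \<U> \<in> \<N>\<close> by blast
    next
      case False
      then obtain x where x: "x \<in> Z0" by blast
      then have xX: "x \<in> X" and Z0s: "Z0 \<subseteq> St {x} \<Z>"
        using uD(2)[OF Z(1)] Z0 unfolding is_cover_def St_def by blast+
      obtain M where "M \<in> \<N>" "St {x} \<Z> \<subseteq> M" using fine[OF xX] by auto
      then show ?thesis using Z0s by (meson order_trans)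
    qed
  qed
  moreover have "is_cover X \<N>"
    unfolding is_cover_def
  proof (intro conjI subset_antisym)
    show "\<N> \<subseteq> Pow X" unfolding \<N>_def N_def by blast
    then show "\<Union>\<N> \<subseteq> X" by blast
    show "X \<subseteq> \<Union>\<N>" using calculation uD(2)[OF Z(1)] unfolding cover_refines_def is_cover_def by blast
  qed
  ultimately have "\<N> \<in> \<mu>" using uD(3)[OF Z(1)] by blast
  then have "\<N> \<in> sf_base X \<mu>" using sfN opN unfolding sf_base_def \<N>_def by blast
  then show ?thesis using bary by blast
qed

lemma sf_base_meet:
  assumes u: "covering_uniformity X \<mu>" and A: "\<A> \<in> sf_base X \<mu>" and B: "\<B> \<in> sf_base X \<mu>"
  shows "\<exists>\<C>\<in>sf_base X \<mu>. cover_refines \<C> \<A> \<and> cover_refines \<C> \<B>"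
proof -
  note uD = covering_uniformityD[OF u]
  have AB: "\<A> \<in> \<mu>" "\<B> \<in> \<mu>" using A B unfolding sf_base_def by blast+
  define \<C> where "\<C> = (\<lambda>(A, B). A \<inter> B) ` (\<A> \<times> \<B>)"
  have CI: "A0 \<inter> B0 \<in> \<C>" if "A0 \<in> \<A>" "B0 \<in> \<B>" for A0 B0
    using that unfolding \<C>_def by auto
  have CE: "\<exists>A0\<in>\<A>. \<exists>B0\<in>\<B>. M = A0 \<inter> B0" if "M \<in> \<C>" for M
    using that unfolding \<C>_def by auto
  obtain \<W> where W: "\<W> \<in> \<mu>" "cover_refines \<W> \<A>" "cover_refines \<W> \<B>"
    using uD(5)[OF AB] by blast
  have r: "cover_refines \<W> \<C>"
    unfolding cover_refines_def
  proof
    fix W assume W': "W \<in> \<W>"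
    obtain A0 where A0: "A0 \<in> \<A>" "W \<subseteq> A0"
      using W(2) W' unfolding cover_refines_def by auto
    obtain B0 where B0: "B0 \<in> \<B>" "W \<subseteq> B0"
      using W(3) W' unfolding cover_refines_def by auto
    show "\<exists>C\<in>\<C>. W \<subseteq> C" using CI[OF A0(1) B0(1)] A0(2) B0(2) by (meson Int_greatest)
  qed
  have c: "is_cover X \<C>"
    unfolding is_cover_def
  proof (intro conjI subset_antisym subsetI)
    fix M assume "M \<in> \<C>"
    then obtain A0 B0 where "A0 \<in> \<A>" "M = A0 \<inter> B0" using CE by meson
    then show "M \<in> Pow X" using uD(2)[OF AB(1)] unfolding is_cover_def by auto
  next
    fix x assume "x \<in> \<Union>\<C>"
    then obtain A0 B0 where "A0 \<in> \<A>" "x \<in> A0 \<inter> B0" using CE by (metis UnionE)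
    then show "x \<in> X" using uD(2)[OF AB(1)] unfolding is_cover_def by auto
  next
    fix x assume x: "x \<in> X"
    obtain A0 where A0: "A0 \<in> \<A>" "x \<in> A0"
      using uD(2)[OF AB(1)] x unfolding is_cover_def by auto
    obtain B0 where B0: "B0 \<in> \<B>" "x \<in> B0"
      using uD(2)[OF AB(2)] x unfolding is_cover_def by auto
    show "x \<in> \<Union>\<C>" using CI[OF A0(1) B0(1)] A0(2) B0(2) by (meson IntI UnionI)
  qed
  have C\<mu>: "\<C> \<in> \<mu>" by (rule uD(3)[OF W(1) c r])
  have s: "star_finite \<C>"
    unfolding star_finite_def
  proof
    fix M assume "M \<in> \<C>"
    then obtain A0 B0 where M: "M = A0 \<inter> B0" "A0 \<in> \<A>" "B0 \<in> \<B>" using CE by meson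
    let ?D = "{A' \<in> \<A>. A' \<inter> A0 \<noteq> {}} \<times> {B' \<in> \<B>. B' \<inter> B0 \<noteq> {}}"
    have "finite ?D"
      using A B M(2,3) unfolding sf_base_def star_finite_def by auto
    moreover have "{M' \<in> \<C>. M' \<inter> M \<noteq> {}} \<subseteq> (\<lambda>(A, B). A \<inter> B) ` ?D"
    proof
      fix M' assume M': "M' \<in> {M' \<in> \<C>. M' \<inter> M \<noteq> {}}"
      then obtain A' B' where AB': "M' = A' \<inter> B'" "A' \<in> \<A>" "B' \<in> \<B>" using CE by blast
      then have "(A', B') \<in> ?D" using M' M(1) by auto
      then show "M' \<in> (\<lambda>(A, B). A \<inter> B) ` ?D" using AB'(1) by (intro image_eqI[of _ _ "(A', B')"]) simp_all
    qed
    ultimately show "finite {M' \<in> \<C>. M' \<inter> M \<noteq> {}}" by (meson finite_imageI finite_subset)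
  qed
  have "openin (unif_topology X \<mu>) M" if "M \<in> \<C>" for M
    using CE[OF that] A B unfolding sf_base_def by auto
  then have "\<C> \<in> sf_base X \<mu>" using s C\<mu> unfolding sf_base_def by simp
  moreover have "cover_refines \<C> \<A>" "cover_refines \<C> \<B>"
    using CE unfolding cover_refines_def by (metis Int_lower1, metis Int_lower2)
  ultimately show ?thesis by blast
qed

lemma covering_uniformity_sf:
  assumes u: "covering_uniformity X \<mu>"
  shows "covering_uniformity X (sf_uniformity X \<mu>)"
proof -
  note uD = covering_uniformityD[OF u]
  have base: "\<U> \<in> sf_uniformity X \<mu>" if "\<U> \<in> sf_base X \<mu>" for \<U>
    using that uD(2) unfolding sf_uniformity_def sf_base_def cover_refines_def by blast
  obtain \<U> where "\<U> \<in> \<mu>" using uD(1) by blast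
  then have "{X} \<in> \<mu>"
    using uD(3)[of \<U> "{X}"] uD(2)[of \<U>] unfolding is_cover_def cover_refines_def by blast
  then have "{X} \<in> sf_base X \<mu>"
    using openin_topspace[of "unif_topology X \<mu>"] openin_unif_topology(2)[OF u]
    unfolding sf_base_def star_finite_def by auto
  then have 1: "sf_uniformity X \<mu> \<noteq> {}" using base by blast
  have 2: "\<V> \<in> sf_uniformity X \<mu>"
    if UV: "\<U> \<in> sf_uniformity X \<mu>" "is_cover X \<V>" "cover_refines \<U> \<V>" for \<U> \<V>
  proof -
    obtain \<B> where B: "\<B> \<in> sf_base X \<mu>" "cover_refines \<B> \<U>"
      using UV(1) unfolding sf_uniformity_def by blast
    have "cover_refines \<B> \<V>" using cover_refines_trans[OF B(2) UV(3)] .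
    then show ?thesis using B(1) UV(2) unfolding sf_uniformity_def by blast
  qed
  have 3: "\<exists>\<W>\<in>sf_uniformity X \<mu>. star_refines \<W> \<U> \<and> star_refines \<W> \<V>"
    if UV: "\<U> \<in> sf_uniformity X \<mu>" "\<V> \<in> sf_uniformity X \<mu>" for \<U> \<V>
  proof -
    obtain \<A> \<B> where AB: "\<A> \<in> sf_base X \<mu>" "cover_refines \<A> \<U>" "\<B> \<in> sf_base X \<mu>" "cover_refines \<B> \<V>"
      using UV unfolding sf_uniformity_def by blast
    obtain \<C> where C: "\<C> \<in> sf_base X \<mu>" "cover_refines \<C> \<A>" "cover_refines \<C> \<B>"
      using sf_base_meet[OF u AB(1,3)] by blast
    obtain \<M> where M: "\<M> \<in> sf_base X \<mu>" "\<forall>x\<in>X. \<exists>A\<in>\<C>. St {x} \<M> \<subseteq> A"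
      using sf_base_barycentric[OF u C(1)] by blast
    obtain \<N> where N: "\<N> \<in> sf_base X \<mu>" "\<forall>x\<in>X. \<exists>A\<in>\<M>. St {x} \<N> \<subseteq> A"
      using sf_base_barycentric[OF u M(1)] by blast
    have cN: "is_cover X \<N>" using N(1) uD(2) unfolding sf_base_def by blast
    have cM: "is_cover X \<M>" using M(1) uD(2) unfolding sf_base_def by blast
    have "\<exists>A\<in>\<C>. St W \<N> \<subseteq> A" if W: "W \<in> \<N>" "W \<noteq> {}" for W
    proof -
      obtain w where w: "w \<in> W" "w \<in> X" using W cN unfolding is_cover_def by blast
      obtain A where A: "A \<in> \<C>" "St {w} \<M> \<subseteq> A" using M(2) w by blast
      have "St W \<N> \<subseteq> St {w} \<M>"
      proof
        fix y assume "y \<in> St W \<N>"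
        then obtain W' v where W': "W' \<in> \<N>" "y \<in> W'" "v \<in> W'" "v \<in> W" unfolding St_def by blast
        then have "v \<in> X" using cN unfolding is_cover_def by blast
        then obtain M0 where M0: "M0 \<in> \<M>" "St {v} \<N> \<subseteq> M0" using N(2) by blast
        have "w \<in> St {v} \<N>" "y \<in> St {v} \<N>" using W w W' unfolding St_def by blast+
        then show "y \<in> St {w} \<M>" using M0 unfolding St_def by blast
      qed
      then show ?thesis using A by blast
    qed
    note nonempty = this
    have "star_refines \<N> \<D>" if D: "cover_refines \<C> \<D>" "\<D> \<noteq> {}" for \<D>
      unfolding star_refines_def cover_refines_def ball_simps
    proof
      fix W assume W: "W \<in> \<N>"
      show "\<exists>D\<in>\<D>. St W \<N> \<subseteq> D"
      proof (cases "W = {}")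
        case True
        then have "St W \<N> = {}" unfolding St_def by auto
        then show ?thesis using D(2) by auto
      next
        case False
        obtain A where A: "A \<in> \<C>" "St W \<N> \<subseteq> A" using nonempty[OF W False] by auto
        obtain D where "D \<in> \<D>" "A \<subseteq> D" using D(1) A(1) unfolding cover_refines_def by auto
        then show ?thesis using A(2) by (meson order_trans)
      qed
    qed
    moreover have "cover_refines \<C> \<U>" "cover_refines \<C> \<V>"
      using AB C cover_refines_trans by blast+
    ultimately have *: "star_refines \<N> \<U> \<and> star_refines \<N> \<V>" if "\<U> \<noteq> {}" "\<V> \<noteq> {}"
      using that by blast
    show ?thesis
    proof (cases "{} \<in> \<mu>")
      case True
      then have "{} \<in> sf_base X \<mu>" unfolding sf_base_def star_finite_def by blast
      then show ?thesis using base unfolding star_refines_def cover_refines_def by blast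
    next
      case False
      have "sf_uniformity X \<mu> \<subseteq> \<mu>" using uD(3) unfolding sf_uniformity_def sf_base_def by blast
      then have "\<U> \<noteq> {}" "\<V> \<noteq> {}" using UV False by blast+
      then show ?thesis using * base[OF N(1)] by blast
    qed
  qed
  show ?thesis unfolding covering_uniformity_def
    using 1 2 3 by (auto simp: sf_uniformity_def)
qed

lemma unif_topology_sf:
  assumes "uniform_space_on X \<mu>"
  shows "unif_topology X (sf_uniformity X \<mu>) = unif_topology X \<mu>"
proof -
  have u: "covering_uniformity X \<mu>" and H: "Hausdorff_space (unif_topology X \<mu>)"
    using assms unfolding uniform_space_on_def by blast+
  note uD = covering_uniformityD[OF u] and op = openin_unif_topology[OF u]
    and ops = openin_unif_topology[OF covering_uniformity_sf[OF u]]
  have sub: "sf_uniformity X \<mu> \<subseteq> \<mu>" using uD(3) unfolding sf_uniformity_def sf_base_def by blast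
  have "openin (unif_topology X (sf_uniformity X \<mu>)) G" if G: "openin (unif_topology X \<mu>) G" for G
    unfolding ops(1)
  proof (intro conjI ballI)
    show GX: "G \<subseteq> X" using G by (simp add: op(1))
    fix x assume x: "x \<in> G"
    then obtain \<U> where U: "\<U> \<in> \<mu>" "St {x} \<U> \<subseteq> G" using G by (auto simp: op(1))
    let ?C = "{G, X - {x}}"
    have c: "is_cover X ?C" using GX x unfolding is_cover_def by blast
    have "cover_refines \<U> ?C"
      unfolding cover_refines_def
    proof
      fix W assume W: "W \<in> \<U>"
      then have "W \<subseteq> X" using uD(2)[OF U(1)] unfolding is_cover_def by blast
      moreover have "W \<subseteq> G" if "x \<in> W" using W that U(2) unfolding St_def by blast
      ultimately show "\<exists>C\<in>?C. W \<subseteq> C" by (cases "x \<in> W") auto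
    qed
    then have "?C \<in> \<mu>" using uD(3)[OF U(1) c] by blast
    moreover have "openin (unif_topology X \<mu>) (X - {x})"
      using closedin_Hausdorff_singleton[OF H, of x] x GX op(2) unfolding closedin_def by auto
    ultimately have "?C \<in> sf_base X \<mu>" using G unfolding sf_base_def star_finite_def by auto
    then have "?C \<in> sf_uniformity X \<mu>"
      using c cover_refines_refl unfolding sf_uniformity_def by (intro CollectI conjI bexI[of _ ?C])
    moreover have "St {x} ?C \<subseteq> G" unfolding St_def by auto
    ultimately show "\<exists>\<U>\<in>sf_uniformity X \<mu>. St {x} \<U> \<subseteq> G" by blast
  qed
  moreover have "openin (unif_topology X \<mu>) G"
    if "openin (unif_topology X (sf_uniformity X \<mu>)) G" for G
    using that sub unfolding ops(1) op(1) by (meson subsetD)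
  ultimately show ?thesis by (auto simp: topology_eq)
qed

lemma uniform_space_on_sf:
  "uniform_space_on X \<mu> \<Longrightarrow> uniform_space_on X (sf_uniformity X \<mu>)"
  using covering_uniformity_sf[of X \<mu>] unif_topology_sf[of X \<mu>] by (simp add: uniform_space_on_def)

end

theory Submission imports Defs begin

text \<open>
  The star-finite modification of a uniform space is again a uniform space with the same
  topology, so it suffices to prove, for an arbitrary uniform space, that compactness is
  equivalent to each of ``Bourbaki-bounded and Bourbaki-complete'' and ``totally bounded and
  complete''.

  In a compact space every filter has a cluster point, which gives both completeness
  properties; and for a uniform cover the interiors of its members already cover the space,
  so finitely many members suffice, which gives total boundedness and hence
  Bourbaki-boundedness (with \<open>m = 0\<close>).

  Conversely, a space in which every ultrafilter has a cluster point is compact. An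
  ultrafilter on a union of finitely many sets contains one of them. Applied to the finite
  subcovers given by total boundedness this shows that every ultrafilter is Cauchy; applied
  to the finitely many iterated stars given by Bourbaki-boundedness it shows that every
  ultrafilter is Bourbaki-Cauchy. The respective completeness then yields the cluster point.
\<close>

section \<open>Ultrafilters\<close>

text \<open>A proper filter that decides every predicate, that is, contains each set or its
  complement.\<close>

definition ultrafilter :: "'a filter \<Rightarrow> bool" where
  "ultrafilter G \<longleftrightarrow> G \<noteq> bot \<and> (\<forall>P. eventually P G \<or> eventually (\<lambda>x. \<not> P x) G)"

text \<open>The order on filters is reverse inclusion of their families of sets, so an
  ultrafilter finer than \<open>F\<close> is one below \<open>F\<close>, found by Zorn's lemma downwards.\<close>

lemma ultrafilter_exists:
  assumes "F \<noteq> bot"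
  obtains G where "ultrafilter G" "G \<le> F"
proof -
  define A where "A = {G. G \<noteq> bot \<and> G \<le> F}"
  define r where "r = {(G, H). G \<in> A \<and> H \<in> A \<and> H \<le> G}"
  have field: "Field r = A" unfolding r_def Field_def by auto
  have po: "Partial_order r"
    unfolding partial_order_on_def preorder_on_def field
    by (auto simp: r_def refl_on_def trans_def antisym_def)
  have ub: "\<exists>u\<in>Field r. \<forall>a\<in>C. (a, u) \<in> r" if C: "C \<in> Chains r" for C
  proof (cases "C = {}")
    case True
    then show ?thesis using assms by (auto simp: field A_def)
  next
    case False
    have CA: "C \<subseteq> A" using C unfolding Chains_def r_def by auto
    have "G \<le> H \<or> H \<le> G" if "G \<in> C" "H \<in> C" for G H
      using C that unfolding Chains_def r_def by auto
    then have dir: "\<exists>x\<in>C. x \<le> inf G H" if "G \<in> C" "H \<in> C" for G H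
      using that by (metis inf.orderE inf_commute order_refl)
    have "eventually P (Inf C) \<longleftrightarrow> (\<exists>G\<in>C. eventually P G)" for P
      by (rule eventually_Inf_base[OF False dir])
    then have "Inf C \<noteq> bot"
      using CA unfolding A_def trivial_limit_def by blast
    moreover obtain G where "G \<in> C" using False by blast
    ultimately have "Inf C \<in> A"
      using CA unfolding A_def by (auto intro: Inf_lower2)
    then have "\<forall>a\<in>C. (a, Inf C) \<in> r" using CA unfolding r_def by (auto intro: Inf_lower)
    then show ?thesis using \<open>Inf C \<in> A\<close> field by blast
  qed
  obtain G where GA: "G \<in> A" and min: "\<forall>H\<in>A. (G, H) \<in> r \<longrightarrow> H = G"
    using Zorns_po_lemma[OF po ub] unfolding field by blast
  have "eventually P G \<or> eventually (\<lambda>x. \<not> P x) G" for P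
  proof (rule disjCI)
    assume n: "\<not> eventually (\<lambda>x. \<not> P x) G"
    let ?H = "inf G (principal {x. P x})"
    have "?H \<noteq> bot" using n by (simp add: trivial_limit_def eventually_inf_principal)
    then have "?H \<in> A" using GA unfolding A_def by (auto intro: le_infI1)
    then have "?H = G" using min GA unfolding r_def by simp
    then have "G \<le> principal {x. P x}" by (metis inf.cobounded2)
    then show "eventually P G" by (simp add: le_principal)
  qed
  then show thesis using that GA unfolding ultrafilter_def A_def by blast
qed

lemma ultrafilter_finite_Union:
  assumes "ultrafilter G" and "finite I" and "eventually (\<lambda>x. x \<in> (\<Union>i\<in>I. S i)) G"
  shows "\<exists>i\<in>I. eventually (\<lambda>x. x \<in> S i) G"
proof (rule ccontr)
  assume "\<not> ?thesis"
  then have "\<forall>i\<in>I. eventually (\<lambda>x. x \<notin> S i) G"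
    using assms(1) unfolding ultrafilter_def by blast
  then have "eventually (\<lambda>x. \<forall>i\<in>I. x \<notin> S i) G"
    using assms(2) by (simp add: eventually_ball_finite)
  with assms(3) have "eventually (\<lambda>x. False) G" by eventually_elim auto
  then show False using assms(1) unfolding ultrafilter_def trivial_limit_def by simp
qed

section \<open>Compactness and cluster points\<close>

lemma compact_space_cluster_point:
  assumes "compact_space T" and "filter_on (topspace T) F"
  shows "\<exists>x. cluster_point T F x"
proof -
  let ?C = "{T closure_of A |A. eventually (\<lambda>x. x \<in> A) F}"
  have ev: "eventually (\<lambda>x. x \<in> C) F" if C: "C \<in> ?C" for C
  proof -
    obtain A where A: "C = T closure_of A" "eventually (\<lambda>x. x \<in> A) F" using C by blast
    have "eventually (\<lambda>x. x \<in> topspace T) F" using assms(2) unfolding filter_on_def by blast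
    with A(2) show ?thesis
      unfolding A(1)
      by eventually_elim (use closure_of_subset_Int[of T A] in blast)
  qed
  have "\<Inter>\<F> \<noteq> {}" if "finite \<F>" "\<F> \<subseteq> ?C" for \<F>
  proof -
    have "eventually (\<lambda>x. \<forall>C\<in>\<F>. x \<in> C) F"
      using that(2) ev by (intro eventually_ball_finite[OF that(1)] ballI) (meson subsetD)
    then obtain x where "\<forall>C\<in>\<F>. x \<in> C"
      using eventually_happens'[of F] assms(2) unfolding filter_on_def by blast
    then show ?thesis by blast
  qed
  moreover have "\<forall>C\<in>?C. closedin T C" by auto
  ultimately have "\<Inter>?C \<noteq> {}"
    using assms(1)[unfolded compact_space_fip, rule_format, of ?C] by presburger
  then obtain x where x: "x \<in> \<Inter>?C" by (meson ex_in_conv)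
  have "x \<in> T closure_of A" if "eventually (\<lambda>x. x \<in> A) F" for A
    using x that by auto
  then show ?thesis by (auto simp: cluster_point_def)
qed

lemma compact_space_if_ultrafilters_cluster:
  assumes "\<And>G. ultrafilter G \<Longrightarrow> filter_on (topspace T) G \<Longrightarrow> \<exists>x. cluster_point T G x"
  shows "compact_space T"
  unfolding compact_space_fip
proof (intro allI impI)
  fix \<C> assume a: "(\<forall>C\<in>\<C>. closedin T C) \<and> (\<forall>\<F>. finite \<F> \<and> \<F> \<subseteq> \<C> \<longrightarrow> \<Inter>\<F> \<noteq> {})"
  show "\<Inter>\<C> \<noteq> {}"
  proof (cases "\<C> = {}")
    case False
    then obtain C0 where C0: "C0 \<in> \<C>" by blast
    let ?F = "INF C\<in>\<C>. principal C"
    have "?F \<noteq> bot"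
    proof (rule INF_filter_not_bot)
      fix \<F> assume "\<F> \<subseteq> \<C>" "finite \<F>"
      then show "(INF C\<in>\<F>. principal C) \<noteq> bot"
        using a by (simp add: INF_principal_finite principal_eq_bot_iff)
    qed
    then obtain G where G: "ultrafilter G" "G \<le> ?F" using ultrafilter_exists by blast
    have mem: "eventually (\<lambda>x. x \<in> C) G" if "C \<in> \<C>" for C
    proof -
      have "G \<le> principal C" using G(2) that by (simp add: le_INF_iff)
      then show ?thesis by (simp add: le_principal)
    qed
    \<comment> \<open>Any one member of \<open>\<C>\<close> keeps the ultrafilter on the space.\<close>
    have "C0 \<subseteq> topspace T" using a C0 closedin_subset by blast
    then have "filter_on (topspace T) G"
      using G(1) mem[OF C0] unfolding filter_on_def ultrafilter_def
      by (auto elim: eventually_mono)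
    then obtain x where "cluster_point T G x" using assms G(1) by blast
    then have "x \<in> T closure_of C" if "C \<in> \<C>" for C
      using mem[OF that] unfolding cluster_point_def by blast
    then have "x \<in> C" if "C \<in> \<C>" for C
      using a that closure_of_closedin[of T C] by metis
    then show ?thesis by auto
  qed simp
qed

section \<open>Bounded and complete uniform spaces\<close>

lemma unif_totally_bounded_imp_Bourbaki_bounded:
  assumes "unif_totally_bounded X \<mu>"
  shows "Bourbaki_bounded X \<mu>"
  unfolding Bourbaki_bounded_def
proof
  fix \<U> assume "\<U> \<in> \<mu>"
  then obtain \<V> where "finite \<V>" "\<V> \<subseteq> \<U>" "X = \<Union>\<V>"
    using assms unfolding unif_totally_bounded_def by blast
  then show "\<exists>m \<V>. finite \<V> \<and> \<V> \<subseteq> \<U> \<and> X \<subseteq> (\<Union>V\<in>\<V>. Stn m V \<U>)"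
    by (intro exI[of _ 0] exI[of _ \<V>]) simp
qed

lemma compact_imp_unif_totally_bounded:
  assumes u: "covering_uniformity X \<mu>" and c: "compact_space (unif_topology X \<mu>)"
  shows "unif_totally_bounded X \<mu>"
  unfolding unif_totally_bounded_def
proof
  fix \<U> assume U: "\<U> \<in> \<mu>"
  note uD = covering_uniformityD[OF u]
  define int where "int A = {z \<in> X. \<exists>\<Q>\<in>\<mu>. St {z} \<Q> \<subseteq> A}" for A
  have int_sub: "int A \<subseteq> A" for A
  proof
    fix z assume "z \<in> int A"
    then obtain \<Q> where Q: "\<Q> \<in> \<mu>" "St {z} \<Q> \<subseteq> A" "z \<in> X" unfolding int_def by blast
    then have "z \<in> St {z} \<Q>" using uD(2)[OF Q(1)] unfolding is_cover_def St_def by blast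
    then show "z \<in> A" using Q by blast
  qed
  have cov: "X \<subseteq> \<Union>(int ` \<U>)"
  proof
    fix x assume x: "x \<in> X"
    obtain \<W> where W: "\<W> \<in> \<mu>" "star_refines \<W> \<U>" using uD(4)[OF U U] by blast
    obtain A where "A \<in> \<U>" "St {x} \<W> \<subseteq> A"
      using star_refines_point[OF W(2) uD(2)[OF W(1)] x] .
    then show "x \<in> \<Union>(int ` \<U>)" using W(1) x unfolding int_def by blast
  qed
  have op: "openin (unif_topology X \<mu>) B" if "B \<in> int ` \<U>" for B
    using that openin_unif_interior[OF u] unfolding int_def by blast
  obtain \<F> where F: "finite \<F>" "\<F> \<subseteq> int ` \<U>" "X \<subseteq> \<Union>\<F>"
    using c cov op unfolding compact_space_alt openin_unif_topology(2)[OF u] by metis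
  obtain \<V> where V: "\<V> \<subseteq> \<U>" "finite \<V>" "\<F> = int ` \<V>"
    using finite_subset_image[OF F(1,2)] by blast
  have "X \<subseteq> \<Union>\<V>" using F(3) V(3) int_sub by blast
  moreover have "\<Union>\<V> \<subseteq> X" using uD(2)[OF U] V(1) unfolding is_cover_def by blast
  ultimately show "\<exists>\<V>. finite \<V> \<and> \<V> \<subseteq> \<U> \<and> X = \<Union>\<V>" using V by blast
qed

lemma compact_iff_unif_totally_bounded_complete:
  assumes u: "covering_uniformity X \<mu>"
  shows "compact_space (unif_topology X \<mu>) \<longleftrightarrow> unif_totally_bounded X \<mu> \<and> unif_complete X \<mu>"
    (is "?L \<longleftrightarrow> ?R")
proof
  assume L: ?L
  have "unif_complete X \<mu>"
    using compact_space_cluster_point[OF L, unfolded openin_unif_topology(2)[OF u]]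
    by (simp add: unif_complete_def Cauchy_filter_on_def)
  then show ?R using compact_imp_unif_totally_bounded[OF u L] by simp
next
  assume R: ?R
  show ?L
  proof (rule compact_space_if_ultrafilters_cluster)
    fix G assume G: "ultrafilter G" "filter_on (topspace (unif_topology X \<mu>)) G"
    then have f: "filter_on X G" by (simp add: openin_unif_topology(2)[OF u])
    have "\<exists>U\<in>\<U>. eventually (\<lambda>x. x \<in> U) G" if U: "\<U> \<in> \<mu>" for \<U>
    proof -
      obtain \<V> where V: "finite \<V>" "\<V> \<subseteq> \<U>" "X = \<Union>\<V>"
        using R U unfolding unif_totally_bounded_def by blast
      have "eventually (\<lambda>x. x \<in> (\<Union>V\<in>\<V>. V)) G" using f V(3) unfolding filter_on_def by simp
      from ultrafilter_finite_Union[OF G(1) V(1) this] show ?thesis using V(2) by blast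
    qed
    then show "\<exists>x. cluster_point (unif_topology X \<mu>) G x"
      using R f by (simp add: unif_complete_def Cauchy_filter_on_def)
  qed
qed

lemma compact_iff_Bourbaki_bounded_complete:
  assumes u: "covering_uniformity X \<mu>"
  shows "compact_space (unif_topology X \<mu>) \<longleftrightarrow> Bourbaki_bounded X \<mu> \<and> Bourbaki_complete X \<mu>"
    (is "?L \<longleftrightarrow> ?R")
proof
  assume L: ?L
  have "Bourbaki_bounded X \<mu>"
    using compact_imp_unif_totally_bounded[OF u L] by (rule unif_totally_bounded_imp_Bourbaki_bounded)
  moreover have "Bourbaki_complete X \<mu>"
    using compact_space_cluster_point[OF L, unfolded openin_unif_topology(2)[OF u]]
    by (simp add: Bourbaki_complete_def Bourbaki_Cauchy_filter_on_def)
  ultimately show ?R by simp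
next
  assume R: ?R
  show ?L
  proof (rule compact_space_if_ultrafilters_cluster)
    fix G assume G: "ultrafilter G" "filter_on (topspace (unif_topology X \<mu>)) G"
    then have f: "filter_on X G" by (simp add: openin_unif_topology(2)[OF u])
    have "\<exists>m. \<exists>U\<in>\<U>. eventually (\<lambda>x. x \<in> Stn m U \<U>) G" if U: "\<U> \<in> \<mu>" for \<U>
    proof -
      obtain m \<V> where V: "finite \<V>" "\<V> \<subseteq> \<U>" "X \<subseteq> (\<Union>V\<in>\<V>. Stn m V \<U>)"
        using R U unfolding Bourbaki_bounded_def by blast
      have "eventually (\<lambda>x. x \<in> X) G" using f unfolding filter_on_def by blast
      then have "eventually (\<lambda>x. x \<in> (\<Union>V\<in>\<V>. Stn m V \<U>)) G"
        by (rule eventually_mono) (use V(3) in blast)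
      from ultrafilter_finite_Union[OF G(1) V(1) this] show ?thesis using V(2) by blast
    qed
    then show "\<exists>x. cluster_point (unif_topology X \<mu>) G x"
      using R f by (simp add: Bourbaki_complete_def Bourbaki_Cauchy_filter_on_def)
  qed
qed

theorem theorem1p2p13:
  fixes X :: "'a set" and \<mu> :: "'a set set set"
  assumes "uniform_space_on X \<mu>"
  shows "(compact_space (unif_topology X \<mu>)
            \<longleftrightarrow> Bourbaki_bounded X \<mu> \<and> Bourbaki_complete X \<mu>)
       \<and> (compact_space (unif_topology X \<mu>)
            \<longleftrightarrow> unif_totally_bounded X \<mu> \<and> unif_complete X \<mu>)
       \<and> (compact_space (unif_topology X \<mu>)
            \<longleftrightarrow> Bourbaki_bounded X (sf_uniformity X \<mu>) \<and> Bourbaki_complete X (sf_uniformity X \<mu>))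
       \<and> (compact_space (unif_topology X \<mu>)
            \<longleftrightarrow> unif_totally_bounded X (sf_uniformity X \<mu>) \<and> unif_complete X (sf_uniformity X \<mu>))"
proof -
  have u: "covering_uniformity X \<mu>" using assms unfolding uniform_space_on_def by blast
  have s: "covering_uniformity X (sf_uniformity X \<mu>)" using u by (rule covering_uniformity_sf)
  note t = unif_topology_sf[OF assms]
  show ?thesis
    by (intro conjI compact_iff_Bourbaki_bounded_complete[OF u]
        compact_iff_unif_totally_bounded_complete[OF u]
        compact_iff_Bourbaki_bounded_complete[OF s, unfolded t]
        compact_iff_unif_totally_bounded_complete[OF s, unfolded t])
qed

end
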